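(* Let $k>1$ be an integer. No online algorithm with advice for the proportional removable knapsack problem \textsc{RemKnap} that reads at most $\log_2 k$ advice bits can achieve a (strict) competitive ratio better than $\dfrac{4}{3-2k+\sqrt{4k(k+1)-7}}$.
   Context: \textsc{RemKnap} (proportional removable knapsack) is the following online maximization problem. An instance is a sequence of items $1,\dots,n$ with sizes $s_1,\dots,s_n\in\mathbb{R}_{>0}$; the knapsack has capacity $1$. For a set $A$ of items, $s(A)=\sum_{i\in A}s_i$. The items are revealed one by one; the algorithm starts with the empty packing $A_0=\emptyset$, and when item $i$ is revealed (and only then does it learn $s_i$) it must choose a new packing $A_i\subseteq A_{i-1}\cup\{i\}$ with $s(A_i)\le 1$. Thus it may remove any previously packed items and may pack the new item, but a removed or rejected item can never be packed again. The algorithm learns $n$ only after choosing $A_n$. The gain is $\mathrm{ALG}(I)=s(A_n)$; $\mathrm{OPT}(I)$ is the maximum of $s(A)$ over all subsets $A$ of the items with $s(A)\le1$. In the advice model, an omniscient oracle that knows the whole instance writes a binary advice string that the algorithm may read. An algorithm is strictly $\rho$-competitive if $\mathrm{OPT}(I)/\mathrm{ALG}(I)\le\rho$ for every instance $I$; its strict competitive ratio is the infimum of all such $\rho$. *)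

theory Defs
  imports Complex_Main "HOL-Library.Extended_Real"
begin

(* An instance lists the item sizes in order of arrival. Items are identified with
   list positions, so the i-th revealed item is i - 1. *)

definition instances :: "real list set" where
  "instances = {I. \<forall>s \<in> set I. 0 < s}"

definition weight :: "real list \<Rightarrow> nat set \<Rightarrow> real" where
  "weight I A = (\<Sum>i\<in>A. I ! i)"

definition feasible :: "real list \<Rightarrow> nat set set" where
  "feasible I = {A. A \<subseteq> {..<length I} \<and> weight I A \<le> 1}"

definition OPT :: "real list \<Rightarrow> real" where
  "OPT I = Max (weight I ` feasible I)"

(* The advice tape is an infinite bit sequence, read sequentially from the left, so that
   no information is conveyed by the length of the advice. *)

type_synonym tape = "nat \<Rightarrow> bool"

(* packing \<phi> I is the packing held after the items of I have been revealed, and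
   bits_read \<phi> I the number of tape cells read by then. Being functions of the revealed
   prefix only, they can depend neither on future items nor on the length of the whole
   instance. By the axiom advice, they depend only on the part of the tape already read. *)

locale remknap_algorithm =
  fixes packing :: "tape \<Rightarrow> real list \<Rightarrow> nat set"
    and bits_read :: "tape \<Rightarrow> real list \<Rightarrow> nat"
  assumes packing_Nil: "packing \<phi> [] = {}"
    and packing_step: "I @ [s] \<in> instances \<Longrightarrow>
      packing \<phi> (I @ [s]) \<subseteq> packing \<phi> I \<union> {length I}"
    and capacity: "I \<in> instances \<Longrightarrow> weight I (packing \<phi> I) \<le> 1"
    and bits_read_step: "I @ [s] \<in> instances \<Longrightarrow>
      bits_read \<phi> I \<le> bits_read \<phi> (I @ [s])"
    and advice: "I \<in> instances \<Longrightarrow> (\<And>j. j < bits_read \<phi> I \<Longrightarrow> \<phi>' j = \<phi> j) \<Longrightarrow>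
      packing \<phi>' I = packing \<phi> I \<and> bits_read \<phi>' I = bits_read \<phi> I"

definition gain :: "(tape \<Rightarrow> real list \<Rightarrow> nat set) \<Rightarrow> (real list \<Rightarrow> tape) \<Rightarrow> real list \<Rightarrow> real" where
  "gain packing oracle_tape I = weight I (packing (oracle_tape I) I)"

(* In ereal, x / 0 is \<infinity> for x > 0, while 0 / 0 = 0: an algorithm with gain 0 is
   penalised exactly when the optimum is positive. *)

definition strictly_competitive ::
    "(tape \<Rightarrow> real list \<Rightarrow> nat set) \<Rightarrow> (real list \<Rightarrow> tape) \<Rightarrow> real \<Rightarrow> bool" where
  "strictly_competitive packing oracle_tape \<rho> \<longleftrightarrow>
     (\<forall>I\<in>instances. ereal (OPT I) / ereal (gain packing oracle_tape I) \<le> ereal \<rho>)"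

(* The value is \<infinity> if there is no finite \<rho>. *)

definition strict_competitive_ratio ::
    "(tape \<Rightarrow> real list \<Rightarrow> nat set) \<Rightarrow> (real list \<Rightarrow> tape) \<Rightarrow> ereal" where
  "strict_competitive_ratio packing oracle_tape =
     Inf {ereal \<rho> |\<rho>. strictly_competitive packing oracle_tape \<rho>}"

end

theory Submission
  imports Defs
begin

text \<open>
  Let \<open>\<alpha>\<close> be the reciprocal of the bound; it is the root of
  \<open>\<alpha>\<^sup>2 = \<alpha> / 2 + (k - 1) (1 - \<alpha>)\<close>. The adversary
  presents \<open>k + 1\<close> items of sizes (slightly perturbed)
  \<open>\<alpha>/2, \<alpha>/2 + (1 - \<alpha>), \<dots>, \<alpha>/2 + (k - 1) (1 - \<alpha>) = \<alpha>\<^sup>2\<close> and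
  \<open>\<alpha>\<close>, any two of which overflow the knapsack. With at most \<open>log\<^sub>2 k\<close> bits there are at
  most \<open>k\<close> different behaviours on this prefix, so some item is kept by none of them. If it is the
  last one, the input stops, and only \<open>\<alpha>\<^sup>2\<close> out of \<open>\<alpha>\<close> is gained; otherwise its complement to
  \<open>1\<close> arrives, and the spacing of the sizes prevents a gain above \<open>\<alpha>\<close>.
\<close>

section \<open>Weights of packings and the competitive inequality\<close>

lemma finite_feasible: "finite (feasible I)"
  by (rule finite_subset[of _ "Pow {..<length I}"]) (auto simp: feasible_def)

lemma weight_le_OPT: "A \<in> feasible I \<Longrightarrow> weight I A \<le> OPT I"
  unfolding OPT_def by (intro Max_ge finite_imageI finite_feasible imageI)

lemma instances_appendD: "I @ J \<in> instances \<Longrightarrow> I \<in> instances"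
  by (auto simp: instances_def)

lemma instances_nth: "I \<in> instances \<Longrightarrow> i < length I \<Longrightarrow> 0 < I ! i"
  by (simp add: instances_def)

lemma weight_nonneg: "I \<in> instances \<Longrightarrow> A \<subseteq> {..<length I} \<Longrightarrow> 0 \<le> weight I A"
  unfolding weight_def by (intro sum_nonneg) (auto intro: less_imp_le instances_nth)

lemma weight_mono:
  assumes "I \<in> instances" "B \<subseteq> {..<length I}" "A \<subseteq> B"
  shows "weight I A \<le> weight I B"
  unfolding weight_def using assms
  by (intro sum_mono2) (auto intro: less_imp_le instances_nth finite_subset)

lemma strictly_competitive_mono:
  "strictly_competitive packing oracle_tape \<rho> \<Longrightarrow> \<rho> \<le> \<rho>' \<Longrightarrow>
    strictly_competitive packing oracle_tape \<rho>'"
  unfolding strictly_competitive_def by (meson ereal_less_eq(3) order_trans)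

text \<open>Turns the extended-real ratio into a plain inequality. A positive optimum rules out gain
  0, since the quotient would then be \<infinity>.\<close>

lemma strictly_competitive_gain:
  assumes "strictly_competitive packing oracle_tape (1 / \<beta>)" "I \<in> instances" "0 < \<beta>"
    and "0 < OPT I" "0 \<le> gain packing oracle_tape I"
  shows "\<beta> * OPT I \<le> gain packing oracle_tape I"
proof (cases "gain packing oracle_tape I = 0")
  case True
  have "ereal (OPT I) / ereal (gain packing oracle_tape I) = \<infinity>"
    using True assms(4) by simp
  then show ?thesis
    using assms(1,2) by (force simp: strictly_competitive_def)
next
  case False
  have "ereal (OPT I) / ereal (gain packing oracle_tape I) \<le> ereal (1 / \<beta>)"
    using assms(1,2) by (auto simp: strictly_competitive_def)
  then have "OPT I / gain packing oracle_tape I \<le> 1 / \<beta>"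
    using False by simp
  then show ?thesis
    using False assms(3,5) by (simp add: field_simps)
qed

section \<open>Online behaviour under bounded advice\<close>

context remknap_algorithm
begin

lemma packing_subset: "I \<in> instances \<Longrightarrow> packing \<phi> I \<subseteq> {..<length I}"
proof (induction I rule: rev_induct)
  case Nil
  then show ?case by (simp add: packing_Nil)
next
  case (snoc s I)
  then show ?case
    using packing_step[OF snoc.prems, of \<phi>] instances_appendD[OF snoc.prems] by fastforce
qed

lemma gain_nonneg: "I \<in> instances \<Longrightarrow> 0 \<le> gain packing oracle_tape I"
  unfolding gain_def by (intro weight_nonneg packing_subset)

text \<open>Pigeonhole on the first \<open>b\<close> bits: if the tapes of two indices agree there,
  \<open>advice\<close> forces the same packing of \<open>I\<close>, which would then contain both
  indices.\<close>

lemma few_packings: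
  assumes "I \<in> instances" "\<And>i. i \<in> A \<Longrightarrow> bits_read (\<phi> i) I \<le> b"
    and "\<And>i. i \<in> A \<Longrightarrow> i \<in> packing (\<phi> i) I"
    and "\<And>i j \<psi>. i \<in> A \<Longrightarrow> j \<in> A \<Longrightarrow> i \<noteq> j \<Longrightarrow> i \<in> packing \<psi> I \<Longrightarrow> j \<notin> packing \<psi> I"
  shows "card A \<le> 2 ^ b"
proof -
  let ?h = "\<lambda>i. {l. l < b \<and> \<phi> i l}"
  have "inj_on ?h A"
  proof (rule inj_onI, rule ccontr)
    fix i j assume ij: "i \<in> A" "j \<in> A" "?h i = ?h j" "i \<noteq> j"
    have "\<phi> j l = \<phi> i l" if "l < bits_read (\<phi> i) I" for l
      using ij(3) that assms(2)[OF ij(1)] by (fastforce simp: set_eq_iff)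
    then have "packing (\<phi> j) I = packing (\<phi> i) I"
      using advice[OF assms(1)] by blast
    then show False
      using assms(3,4) ij by metis
  qed
  moreover have "?h ` A \<subseteq> Pow {..<b}" by auto
  ultimately have "card A \<le> card (Pow {..<b})"
    by (intro card_inj_on_le) auto
  then show ?thesis by (simp add: card_Pow)
qed

text \<open>Each of the \<open>n + 1\<close> items has an instance whose tape must make the
  algorithm hold that item after the common prefix, so \<open>few_packings\<close> applies. The
  hypotheses \<open>big\<close>, \<open>gap\<close> and \<open>small\<close> bound the packings that
  lack the demanded item: respectively the complement alone, the complement with a smaller item, and
  a single item.\<close>

lemma adversary:
  fixes y :: "nat \<Rightarrow> real" and n b :: nat
  assumes comp: "strictly_competitive packing oracle_tape (1 / \<beta>)"
    and beta: "0 < \<beta>"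
    and bits: "\<And>I. I \<in> instances \<Longrightarrow> bits_read (oracle_tape I) I \<le> b"
    and overflow: "\<And>i j. i < j \<Longrightarrow> j \<le> n \<Longrightarrow> 1 < y i + y j"
    and gap: "\<And>i j. i < j \<Longrightarrow> j < n \<Longrightarrow> 1 - \<beta> < y j - y i"
    and pos: "\<And>i. i \<le> n \<Longrightarrow> 0 < y i"
    and big: "\<And>i. i < n \<Longrightarrow> 1 - \<beta> < y i"
    and small: "\<And>i. i \<le> n \<Longrightarrow> y i < \<beta>" "\<And>i. i < n \<Longrightarrow> y i < \<beta> * y n"
    and beta1: "\<beta> < 1"
  shows "n + 1 \<le> 2 ^ b"
proof -
  define S where "S = map y [0..<Suc n]"
  define T where "T i = S @ [1 - y i]" for i
  \<comment> \<open>The instance that forces item \<open>i\<close>; for the last item the prefix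
    itself suffices.\<close>
  define U where "U i = (if i = n then S else T i)" for i
  have len: "length S = Suc n" by (simp add: S_def)
  have nth: "S ! i = y i" if "i \<le> n" for i
    using that unfolding S_def by (subst nth_map) (auto simp del: upt_Suc)
  have S: "S \<in> instances"
    using pos by (auto simp: S_def instances_def)
  have T: "T i \<in> instances" if "i < n" for i
    using S small(1)[of i] that beta1 by (auto simp: T_def instances_def)
  have two: "j \<notin> packing \<psi> S" if "i \<le> n" "j \<le> n" "i \<noteq> j" "i \<in> packing \<psi> S" for i j \<psi>
  proof
    assume "j \<in> packing \<psi> S"
    then have "weight S {i, j} \<le> weight S (packing \<psi> S)"
      using that by (intro weight_mono packing_subset S) auto
    moreover have "weight S {i, j} = y i + y j"
      using that nth by (simp add: weight_def)
    moreover have "1 < y i + y j"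
      using overflow[of i j] overflow[of j i] that by linarith
    ultimately show False
      using capacity[OF S, of \<psi>] by simp
  qed
  have single: "packing \<psi> S = {} \<or> (\<exists>j\<le>n. packing \<psi> S = {j})" for \<psi>
  proof (cases "packing \<psi> S = {}")
    case False
    then obtain j where j: "j \<in> packing \<psi> S" by blast
    have le: "i \<le> n" if "i \<in> packing \<psi> S" for i
      using packing_subset[OF S, of \<psi>] that len by auto
    have "i = j" if "i \<in> packing \<psi> S" for i
      using two[OF le[OF j] le[OF that] _ j] that by blast
    then show ?thesis using j le[OF j] by blast
  qed simp
  have last: "n \<in> packing (oracle_tape S) S"
  proof (rule ccontr)
    assume n: "n \<notin> packing (oracle_tape S) S"
    have "weight S {n} = y n" by (simp add: weight_def nth)
    moreover have "{n} \<in> feasible S"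
      using small(1)[of n] beta1 by (simp add: feasible_def len weight_def nth)
    ultimately have opt: "y n \<le> OPT S"
      using weight_le_OPT by metis
    then have "\<beta> * y n \<le> \<beta> * OPT S" using beta by simp
    also have "\<dots> \<le> weight S (packing (oracle_tape S) S)"
      using strictly_competitive_gain[OF comp S beta _ gain_nonneg[OF S]] opt pos[of n]
      by (simp add: gain_def)
    \<comment> \<open>At most one item is held, and by \<open>small(2)\<close> any item other than
      \<open>n\<close> falls short of the required gain.\<close>
    also have "\<dots> < \<beta> * y n"
    proof (cases "packing (oracle_tape S) S = {}")
      case True
      then show ?thesis using beta pos[of n] by (simp add: weight_def)
    next
      case False
      then obtain j where "j \<le> n" "packing (oracle_tape S) S = {j}"
        using single by blast
      then show ?thesis
        using n small(2)[of j] by (cases "j = n") (auto simp: weight_def nth)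
    qed
    finally show False by simp
  qed
  have other: "i \<in> packing (oracle_tape (T i)) S" if i: "i < n" for i
  proof (rule ccontr)
    let ?\<phi> = "oracle_tape (T i)"
    let ?P = "packing ?\<phi> S" and ?Q = "packing ?\<phi> (T i)"
    assume n: "i \<notin> ?P"
    have w: "weight (T i) {j, Suc n} = y j + (1 - y i)" if "j \<le> n" for j
      using that len by (simp add: weight_def T_def nth_append nth)
    have "{i, Suc n} \<in> feasible (T i)"
      using w[of i] i by (simp add: feasible_def len T_def)
    then have opt: "1 \<le> OPT (T i)"
      using weight_le_OPT w[of i] i by fastforce
    then have "\<beta> \<le> \<beta> * OPT (T i)" using beta by simp
    also have "\<dots> \<le> weight (T i) ?Q"
      using strictly_competitive_gain[OF comp T[OF i] beta _ gain_nonneg[OF T[OF i]]] opt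
      by (simp add: gain_def)
    finally have ge: "\<beta> \<le> weight (T i) ?Q" .
    have Q: "?Q \<subseteq> ?P \<union> {Suc n}"
      using packing_step[of S "1 - y i" ?\<phi>] T[OF i] len by (simp add: T_def)
    have w1: "weight (T i) {Suc n} = 1 - y i" "weight (T i) {} = 0"
      using len by (simp_all add: weight_def T_def nth_append)
    have w2: "weight (T i) {j} = y j" if "j \<le> n" for j
      using that len by (simp add: weight_def T_def nth_append nth)
    \<comment> \<open>The complement has index \<open>Suc n\<close>, and at most one old item,
      different from \<open>i\<close>, survives; this leaves four shapes.\<close>
    consider "?Q = {}" | "?Q = {Suc n}" | j where "j \<le> n" "j \<noteq> i" "?Q = {j}"
      | j where "j \<le> n" "j \<noteq> i" "?Q = {j, Suc n}"
    proof -
      assume *: "?Q = {} \<Longrightarrow> thesis" "?Q = {Suc n} \<Longrightarrow> thesis"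
        "\<And>j. j \<le> n \<Longrightarrow> j \<noteq> i \<Longrightarrow> ?Q = {j} \<Longrightarrow> thesis"
        "\<And>j. j \<le> n \<Longrightarrow> j \<noteq> i \<Longrightarrow> ?Q = {j, Suc n} \<Longrightarrow> thesis"
      from single[of ?\<phi>] show thesis
      proof
        assume "?P = {}"
        then have "?Q = {} \<or> ?Q = {Suc n}" using Q by auto
        then show thesis using *(1,2) by blast
      next
        assume "\<exists>j\<le>n. ?P = {j}"
        then obtain j where j: "j \<le> n" "?P = {j}" by blast
        then have "?Q = {} \<or> ?Q = {Suc n} \<or> ?Q = {j} \<or> ?Q = {j, Suc n}" using Q by auto
        then show thesis using *(1,2) *(3,4)[of j] j n by blast
      qed
    qed
    then show False
    proof cases
      case (4 j)
      \<comment> \<open>Capacity excludes every item larger than \<open>y i\<close>, hence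
        \<open>j < i\<close>; then \<open>gap\<close> leaves a gain below
        \<open>1 - (1 - \<beta>) = \<beta>\<close>.\<close>
      then have "y j \<le> y i"
        using capacity[OF T[OF i], of ?\<phi>] w[of j] by simp
      moreover have "y i < y n"
        using small(2)[OF i] beta1 pos[of n] mult_strict_right_mono[of \<beta> 1 "y n"] by linarith
      ultimately have "j < i"
        using gap[of i j] 4 beta1 by (cases i j rule: linorder_cases; cases "j = n") auto
      then show ?thesis
        using ge 4 w[of j] gap[of j i] i by simp
    next
      case (3 j)
      then show ?thesis using ge w2[of j] small(1)[of j] by simp
    qed (use ge beta w1 big[OF i] in simp_all)
  qed
  have "card {..n} \<le> 2 ^ b"
  proof (rule few_packings[OF S, where \<phi> = "\<lambda>i. oracle_tape (U i)"])
    fix i assume i: "i \<in> {..n}"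
    \<comment> \<open>The bound \<open>b\<close> concerns the whole instance; it carries over to the
      prefix because the number of bits read never decreases.\<close>
    have "bits_read (oracle_tape (T i)) S \<le> bits_read (oracle_tape (T i)) (T i)" if "i < n"
      using bits_read_step T[OF that] by (simp add: T_def)
    then show "bits_read (oracle_tape (U i)) S \<le> b"
      using i bits[OF S] bits[OF T[of i]] by (cases "i = n") (auto simp: U_def)
    show "i \<in> packing (oracle_tape (U i)) S"
      using i last other[of i] by (cases "i = n") (auto simp: U_def)
  qed (use two in auto)
  then show ?thesis by simp
qed

end

section \<open>Choice of the item sizes\<close>

theorem theorem6:
  fixes k :: nat
    and packing :: "tape \<Rightarrow> real list \<Rightarrow> nat set"
    and bits_read :: "tape \<Rightarrow> real list \<Rightarrow> nat"
    and oracle_tape :: "real list \<Rightarrow> tape"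
  assumes "k > 1"
    and "remknap_algorithm packing bits_read"
    and "\<forall>I\<in>instances. real (bits_read (oracle_tape I) I) \<le> log 2 (real k)"
  shows "ereal (4 / (3 - 2 * real k + sqrt (4 * real k * (real k + 1) - 7)))
         \<le> strict_competitive_ratio packing oracle_tape"
proof -
  interpret remknap_algorithm packing bits_read by (rule assms(2))
  define r where "r = sqrt (4 * real k * (real k + 1) - 7)"
  define a where "a = (3 - 2 * real k + r) / 4"
  have k: "2 \<le> real k" using assms(1) by simp
  have "2 * 2 \<le> real k * real k" by (intro mult_mono k) auto
  then have rad: "0 \<le> 4 * real k * (real k + 1) - 7" using k by (simp add: algebra_simps)
  then have rr: "r\<^sup>2 = 4 * real k * (real k + 1) - 7" by (simp add: r_def)
  \<comment> \<open>The constant yields \<open>2 / 3 < a\<close>, so that later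
    \<open>1 - \<beta> < \<beta> / 2\<close>: a complement alone gains less than \<beta>.\<close>
  have "2 * real k - 1 / 3 < r"
    unfolding r_def by (rule real_less_rsqrt) (use k in \<open>simp add: power2_eq_square algebra_simps\<close>)
  then have a23: "2 / 3 < a" by (simp add: a_def)
  have root: "a\<^sup>2 = a / 2 + (real k - 1) * (1 - a)"
    using rr by (simp add: a_def power2_eq_square field_simps)
  have "ereal (1 / a) \<le> strict_competitive_ratio packing oracle_tape"
    unfolding strict_competitive_ratio_def
  proof (rule Inf_greatest, clarify, rule ccontr)
    fix \<rho> assume comp: "strictly_competitive packing oracle_tape \<rho>"
      and "\<not> ereal (1 / a) \<le> ereal \<rho>"
    moreover have "1 < 1 / a"
    proof -
      have "r < 2 * real k + 1"
        unfolding r_def by (rule real_less_lsqrt) (use k in \<open>simp_all add: power2_eq_square algebra_simps\<close>)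
      then show ?thesis using a23 by (simp add: a_def)
    qed
    \<comment> \<open>Staying strictly below \<open>1 / a\<close> gives \<open>a < \<beta>\<close>
      and thus room for perturbation; \<open>1 < m\<close> ensures
      \<open>\<beta> < 1\<close>.\<close>
    ultimately obtain m where m: "max \<rho> 1 < m" "m < 1 / a"
      using dense[of "max \<rho> 1" "1 / a"] by auto
    define \<beta> where "\<beta> = 1 / m"
    have \<beta>: "a < \<beta>" "\<beta> < 1" "1 / \<beta> = m"
      using m a23 by (auto simp: \<beta>_def field_simps)
    \<comment> \<open>The slack at \<beta> in the quadratic equation for \<open>a\<close>; it
      factors because \<open>a\<close> is a root.\<close>
    define f where "f = \<beta>\<^sup>2 - \<beta> / 2 - (real k - 1) * (1 - \<beta>)"
    have "f = (\<beta> - a) * (\<beta> + a - 3 / 2 + real k)"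
      using root by (simp add: f_def power2_eq_square field_simps)
    then have f: "0 < f"
      using \<beta> a23 k by simp
    \<comment> \<open>Widening each spacing and lowering the last item by \<open>e\<close> costs
      \<open>(real k - 1 + \<beta>) * e\<close> in comparing \<open>y (k - 1)\<close> with
      \<open>\<beta> * y k\<close>. The divisor \<open>2 * real k\<close> exceeds that coefficient,
      so the cost stays below \<open>f\<close>.\<close>
    define e where "e = f / (2 * real k)"
    have e: "0 < e" "(real k - 1 + \<beta>) * e < f"
    proof -
      show "0 < e" using f k by (simp add: e_def)
      then have "(real k - 1 + \<beta>) * e < (2 * real k) * e"
        using \<beta> k by (intro mult_strict_right_mono) auto
      then show "(real k - 1 + \<beta>) * e < f" using k by (simp add: e_def)
    qed
    define g where "g = 1 - \<beta> + e"
    define y where "y i = (if i = k then \<beta> - e else \<beta> / 2 + real i * g)" for i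
    have g: "1 - \<beta> < g" "0 < g" using e \<beta> by (auto simp: g_def)
    have b0: "2 / 3 < \<beta>" using a23 \<beta> by simp
    have yk: "y i < \<beta> * y k" if "i < k" for i
    proof -
      have "real i * g \<le> (real k - 1) * g" using that g by (intro mult_right_mono) auto
      then have "y i \<le> \<beta> / 2 + (real k - 1) * g" using that by (simp add: y_def)
      also have "\<dots> < \<beta> * (\<beta> - e)"
        using e(2) by (simp add: g_def f_def power2_eq_square algebra_simps)
      finally show ?thesis by (simp add: y_def)
    qed
    have half: "\<beta> / 2 \<le> y i" if "i < k" for i using that g by (simp add: y_def)
    have ykpos: "0 < y k"
    proof -
      have "0 < \<beta> * y k" using yk[of 0] half[of 0] k b0 by simp
      then show ?thesis using b0 by (simp add: zero_less_mult_iff)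
    qed
    have lt: "y i < y k" if "i < k" for i
      using yk[OF that] mult_strict_right_mono[OF \<beta>(2) ykpos] by linarith
    have step: "y i + g \<le> y j" if "i < j" "j < k" for i j
    proof -
      have "(real i + 1) * g \<le> real j * g" using that g by (intro mult_right_mono) auto
      then show ?thesis using that by (simp add: y_def algebra_simps)
    qed
    \<comment> \<open>The number of bits read is an integer, so its bound can be rounded
      down.\<close>
    have "k + 1 \<le> 2 ^ nat \<lfloor>log 2 (real k)\<rfloor>"
    proof (rule adversary[where oracle_tape = oracle_tape and \<beta> = \<beta> and y = y])
      show "strictly_competitive packing oracle_tape (1 / \<beta>)"
        using strictly_competitive_mono[OF comp] m \<beta>(3) by simp
      show "bits_read (oracle_tape I) I \<le> nat \<lfloor>log 2 (real k)\<rfloor>" if "I \<in> instances" for I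
        using assms(3) that by (simp add: le_nat_floor)
      show "1 < y i + y j" if "i < j" "j \<le> k" for i j
      proof (cases "j = k")
        case True
        \<comment> \<open>Since \<open>k > 1\<close>, item 1 is not the last one, so the last item
          exceeds it and \<open>y 0 + y 1\<close> bounds the sum from below.\<close>
        have "1 < y 0 + y 1"
          using k g half[of 0] step[of 0 1] by (simp add: y_def)
        moreover have "y 1 < y j" using lt[of 1] k True by simp
        moreover have "y 0 \<le> y i" using that g by (simp add: y_def)
        ultimately show ?thesis by simp
      next
        case False
        then show ?thesis using that step[of i j] half[of i] g by simp
      qed
      show "1 - \<beta> < y j - y i" if "i < j" "j < k" for i j
        using step[OF that] g by simp
      show "0 < y i" if "i \<le> k" for i
        using that half[of i] ykpos b0 by (cases "i = k") auto
      show "1 - \<beta> < y i" if "i < k" for i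
        using half[OF that] b0 by simp
      show "y i < \<beta>" if "i \<le> k" for i
      proof -
        have "y k < \<beta>" using e(1) by (simp add: y_def)
        then show ?thesis using that lt[of i] by (cases "i = k") auto
      qed
    qed (use b0 \<beta> yk in auto)
    moreover have "(2::real) ^ nat \<lfloor>log 2 (real k)\<rfloor> \<le> real k"
    proof -
      have "0 \<le> log 2 (real k)" using k by simp
      then have "2 powr real (nat \<lfloor>log 2 (real k)\<rfloor>) \<le> 2 powr (log 2 (real k))"
        by (intro powr_mono) auto
      also have "2 powr (log 2 (real k)) = real k" using k by simp
      finally show ?thesis by (subst (asm) powr_realpow) simp_all
    qed
    then have "2 ^ nat \<lfloor>log 2 (real k)\<rfloor> \<le> k"
      by (metis of_nat_le_iff of_nat_numeral of_nat_power)
    ultimately show False by simp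
  qed
  then show ?thesis by (simp add: a_def r_def)
qed

end
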